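(* Fix an integer $r\geq 2$ and $\varepsilon>0$. There is a number $C(\varepsilon,r)$ such that for all sufficiently large $t$ and every integer $n>t^{C(\varepsilon,r)}$ there exist an $r$-uniform hypergraph $G$ and a $t$-thick partition $\mathcal P=\{V_1,\dots,V_n\}$ of $V(G)$ such that for each $i$ at most $\left(\frac{(r-1)^{r-1}}{r^r}+\varepsilon\right)t^r$ edges of $G$ intersect $V_i$ (all edges being stretched), every vertex of $G$ lies in at most $\left(1-\frac{(r-1)^{r-1}}{3r^r}\right)t^{r-1}$ edges, and $\mathcal P$ has no independent transversal in $G$.
   Context: An $r$-uniform hypergraph has all edges of size $r$; $\Delta(G)$ denotes the maximum number of edges containing a single vertex. A partition $\mathcal P$ of $V(G)$ into blocks is $t$-thick if every block has at least $t$ vertices. An edge is stretched if its vertices lie in pairwise distinct blocks. An independent transversal of $\mathcal P$ in $G$ is a set of vertices meeting each block in exactly one vertex and containing no edge of $G$. *)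

theory Defs
  imports Complex_Main "HOL-Library.Disjoint_Sets"
begin

(* A hypergraph is given by its vertex set V and its edge set E. *)
definition uniform_hypergraph :: "nat \<Rightarrow> 'a set \<Rightarrow> 'a set set \<Rightarrow> bool" where
  "uniform_hypergraph r V E \<longleftrightarrow> finite V \<and> (\<forall>e\<in>E. e \<subseteq> V \<and> card e = r)"

definition degree :: "'a set set \<Rightarrow> 'a \<Rightarrow> nat" where
  "degree E v = card {e \<in> E. v \<in> e}"

(* card is 0 on infinite sets, so this is only meant for finite blocks. *)
definition thick :: "nat \<Rightarrow> 'a set set \<Rightarrow> bool" where
  "thick t P \<longleftrightarrow> (\<forall>B\<in>P. t \<le> card B)"

definition stretched :: "'a set set \<Rightarrow> 'a set \<Rightarrow> bool" where
  "stretched P e \<longleftrightarrow> (\<forall>u\<in>e. \<forall>v\<in>e. u \<noteq> v \<longrightarrow> \<not> (\<exists>B\<in>P. u \<in> B \<and> v \<in> B))"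

definition independent_transversal :: "'a set \<Rightarrow> 'a set set \<Rightarrow> 'a set set \<Rightarrow> 'a set \<Rightarrow> bool" where
  "independent_transversal V E P T \<longleftrightarrow>
     T \<subseteq> V \<and> (\<forall>B\<in>P. \<exists>!v. v \<in> T \<inter> B) \<and> \<not> (\<exists>e\<in>E. e \<subseteq> T)"

end

(* Let c = (r-1)^(r-1) / r^r. Suppose that F is a family of (r-1)-sets such that every independent
   transversal of some gadget contains a member of F. A new vertex v that is joined to all members
   of F cannot be used by an independent transversal. Treat k of the t vertices of a new
   block in this way, each with its own copy of the gadget: only t - k vertices of the block stay
   available, and r - 1 such blocks form a new gadget with (t-k)^(r-1) links. If |F| = a^(r-1), this
   costs k a^(r-1) edges at the block. Because (t-a) a^(r-1) <= c t^r, the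
   budget (c+eps) t^r always allows k = t - a + q with q about eps t / 2, so that a drops by q in each round
   and reaches 0 after O(1/eps) rounds. Each round multiplies the number of blocks by O(t).

   Starting from r - 1 blocks without edges would produce vertices of degree t^(r-1). Instead, with
   p about c t / 3, one starts from blocks L_0, ..., L_(r-1), with edges that prevent a transversal
   from using the last t - p vertices of L_0 together with the first 2 p vertices of L_1. Links that
   cover the complementary p and t - 2 p vertices then suffice, and there are only (t-p) t^(r-2)
   of them. *)

theory Submission
  imports Defs "HOL-Library.FuncSet" "HOL-Library.Countable"
begin

section \<open>Partial transversals and gadgets with links\<close>

text \<open>Injectivity of \<open>fst\<close> says that such a set meets each block at most once; in
  the final partition this becomes stretchedness.\<close>

definition partial_transversals :: "nat \<Rightarrow> 'i set \<Rightarrow> nat \<Rightarrow> ('i \<times> nat) set set" where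
  "partial_transversals s I t = {e. e \<subseteq> I \<times> {..<t} \<and> card e = s \<and> inj_on fst e}"

text \<open>
  A block is an index \<open>i \<in> I\<close> and its vertices are the pairs \<open>(i, x)\<close> with \<open>x < t\<close>. The sets in \<open>F\<close>
  are links: they become edges of size \<open>r\<close> once a vertex outside the structure is attached to them,
  which is why they already count towards the degrees.
\<close>

definition blocker ::
    "nat \<Rightarrow> nat \<Rightarrow> real \<Rightarrow> real \<Rightarrow> 'i set \<Rightarrow> ('i \<times> nat) set set \<Rightarrow> ('i \<times> nat) set set \<Rightarrow> bool" where
  "blocker r t K \<Delta> I E F \<longleftrightarrow>
     finite I \<and> E \<subseteq> partial_transversals r I t \<and> F \<subseteq> partial_transversals (r - 1) I t \<and>
     (\<forall>i\<in>I. real (card {e\<in>E. i \<in> fst ` e} + card {f\<in>F. i \<in> fst ` f}) \<le> K) \<and>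
     (\<forall>v\<in>I \<times> {..<t}. real (card {e\<in>E. v \<in> e} + card {f\<in>F. v \<in> f}) \<le> \<Delta>) \<and>
     (\<forall>T\<in>I \<rightarrow> {..<t}. \<exists>e\<in>E \<union> F. \<forall>v\<in>e. T (fst v) = snd v)"

lemma finite_partial_transversals:
  "finite I \<Longrightarrow> finite (partial_transversals s I t)"
  unfolding partial_transversals_def
  by (rule finite_subset[of _ "Pow (I \<times> {..<t})"]) auto

lemma blocker_finite:
  assumes "blocker r t K \<Delta> I E F"
  shows "finite I" "finite E" "finite F"
  using assms unfolding blocker_def
  by (auto intro: finite_subset[OF _ finite_partial_transversals])

section \<open>Boxes: complete multipartite hypergraphs on the blocks \<open>[j]\<close>\<close>

text \<open>This is the complete \<open>card J\<close>-partite hypergraph with part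
  \<open>A j\<close> in block \<open>[j]\<close>. Edges are images of extensional functions, so
  \<open>card_PiE\<close> bounds their number.\<close>

definition box :: "nat set \<Rightarrow> (nat \<Rightarrow> nat set) \<Rightarrow> (nat list \<times> nat) set set" where
  "box J A = (\<lambda>g. (\<lambda>j. ([j], g j)) ` J) ` Pi\<^sub>E J A"

lemma finite_box:
  "finite J \<Longrightarrow> (\<And>j. j \<in> J \<Longrightarrow> finite (A j)) \<Longrightarrow> finite (box J A)"
  unfolding box_def by (intro finite_imageI finite_PiE)

lemma card_box_le:
  assumes "finite J" "\<And>j. j \<in> J \<Longrightarrow> finite (A j)"
  shows "card (box J A) \<le> (\<Prod>j\<in>J. card (A j))"
proof -
  have "card (box J A) \<le> card (Pi\<^sub>E J A)"
    unfolding box_def by (intro card_image_le finite_PiE assms)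
  then show ?thesis using card_PiE[OF assms(1), of A] by simp
qed

lemma box_subset_partial_transversals:
  assumes "\<And>j. j \<in> J \<Longrightarrow> [j] \<in> I \<and> A j \<subseteq> {..<t}"
  shows "box J A \<subseteq> partial_transversals (card J) I t"
proof
  fix e assume "e \<in> box J A"
  then obtain g where g: "g \<in> Pi\<^sub>E J A" "e = (\<lambda>j. ([j], g j)) ` J"
    unfolding box_def by auto
  have "card e = card J"
    unfolding g(2) by (rule card_image) (auto simp: inj_on_def)
  then show "e \<in> partial_transversals (card J) I t"
    using g assms unfolding partial_transversals_def by (fastforce simp: inj_on_def PiE_iff)
qed

lemma box_vertexD:
  assumes "e \<in> box J A" "v \<in> e"
  shows "\<exists>j\<in>J. fst v = [j] \<and> snd v \<in> A j"
  using assms unfolding box_def by auto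

lemma box_mem_empty:
  assumes "j \<notin> J \<or> x \<notin> A j"
  shows "{e \<in> box J A. ([j], x) \<in> e} = {}"
  using assms box_vertexD by fastforce

lemma box_degree_le:
  assumes "finite J" "\<And>i. i \<in> J \<Longrightarrow> finite (A i)" "j \<in> J"
  shows "card {e \<in> box J A. ([j], x) \<in> e} * card (A j) \<le> (\<Prod>i\<in>J. card (A i))"
proof -
  let ?B = "\<lambda>i. if i = j then {x} else A i"
  have "{e \<in> box J A. ([j], x) \<in> e} \<subseteq> box J ?B"
    unfolding box_def by (auto simp: PiE_iff split: if_splits)
  then have "card {e \<in> box J A. ([j], x) \<in> e} \<le> card (box J ?B)"
    by (rule card_mono[rotated]) (use assms in \<open>auto intro!: finite_box\<close>)
  also have "\<dots> \<le> (\<Prod>i\<in>J. card (?B i))"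
    by (rule card_box_le) (use assms in auto)
  also have "\<dots> = (\<Prod>i\<in>J - {j}. card (A i))"
    using assms by (subst prod.remove[of _ j]) (auto intro!: prod.cong)
  finally show ?thesis
    using assms prod.remove[of J j "\<lambda>i. card (A i)"] by (simp add: mult.commute)
qed

lemma box_intro:
  assumes "\<And>j. j \<in> J \<Longrightarrow> T [j] \<in> A j"
  shows "\<exists>e\<in>box J A. \<forall>v\<in>e. T (fst v) = snd v"
proof -
  let ?g = "restrict (\<lambda>j. T [j]) J"
  have "?g \<in> Pi\<^sub>E J A" using assms by auto
  then have "(\<lambda>j. ([j], ?g j)) ` J \<in> box J A" unfolding box_def by (rule imageI)
  then show ?thesis by (rule bexI[rotated]) auto
qed

section \<open>One round: attaching copies of a gadget to new blocks\<close>

text \<open>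
  With block indices of type \<^typ>\<open>nat list\<close>, fresh disjoint copies arise by prefixing: \<open>[j]\<close> is the \<open>j\<close>-th
  new block, and \<open>j # l # i\<close> is block \<open>i\<close> in the copy attached to vertex \<open>l\<close> of that block.
\<close>

lemma blocker_step:
  fixes I :: "nat list set"
  assumes bl: "blocker r t K \<Delta> I E F" and r: "r \<ge> 2" and k: "k \<le> t"
    and F: "real (card F) \<le> \<Delta>" and \<Delta>: "real t ^ (r - 2) \<le> \<Delta>"
    and K: "real k * real (card F) + real (t - k) ^ (r - 1) \<le> K"
  shows "\<exists>I' :: nat list set. \<exists>E' F'. blocker r t K \<Delta> I' E' F' \<and>
    card F' \<le> (t - k) ^ (r - 1) \<and> card I' \<le> (r - 1) * (1 + k * card I)"
proof -
  define s where "s = r - 1"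
  have s: "r = Suc s" "s > 0" using r by (auto simp: s_def)
  define emb :: "nat \<Rightarrow> nat \<Rightarrow> nat list \<times> nat \<Rightarrow> nat list \<times> nat"
    where "emb = (\<lambda>j l v. (j # l # fst v, snd v))"
  \<comment> \<open>Adding the root vertex \<open>([j], l)\<close> to a copied link raises its size
    from r - 1 to r, so it becomes an edge.\<close>
  define link where "link = (\<lambda>j l f. insert ([j], l) (emb j l ` f))"
  define I' where "I' = (\<lambda>j. [j]) ` {..<s} \<union> (\<lambda>(j, l, i). j # l # i) ` ({..<s} \<times> {..<k} \<times> I)"
  define E' where "E' = (\<Union>j<s. \<Union>l<k. (`) (emb j l) ` E \<union> link j l ` F)"
  define F' where "F' = box {..<s} (\<lambda>_. {k..<t})"
  note fin = blocker_finite[OF bl]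
  have EF: "E \<subseteq> partial_transversals r I t" "F \<subseteq> partial_transversals s I t"
    and touch: "\<And>i. i \<in> I \<Longrightarrow> real (card {e\<in>E. i \<in> fst ` e} + card {f\<in>F. i \<in> fst ` f}) \<le> K"
    and deg: "\<And>v. v \<in> I \<times> {..<t} \<Longrightarrow> real (card {e\<in>E. v \<in> e} + card {f\<in>F. v \<in> f}) \<le> \<Delta>"
    and noT: "\<And>T. T \<in> I \<rightarrow> {..<t} \<Longrightarrow> \<exists>e\<in>E \<union> F. \<forall>v\<in>e. T (fst v) = snd v"
    using bl unfolding blocker_def s_def by blast+
  have emb_inj: "inj (emb j l)" for j l
    unfolding emb_def by (auto simp: inj_def)
  \<comment> \<open>Root indices have length one, indices in copies have length at least two, and
    their first two entries identify the copy. Hence distinct copies do not interact, and a root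
    vertex meets only links of its own copy.\<close>
  have emb_mem: "emb j l v \<in> emb a b ` f \<longleftrightarrow> a = j \<and> b = l \<and> v \<in> f"
      "emb j l v \<in> link a b f \<longleftrightarrow> a = j \<and> b = l \<and> v \<in> f"
      "([j], l) \<in> emb a b ` f \<longleftrightarrow> False"
      "([j], l) \<in> link a b f \<longleftrightarrow> a = j \<and> b = l" for j l v a b f
    unfolding link_def emb_def by (auto simp: image_iff prod_eq_iff)
  have emb_touch: "j # l # i \<in> fst ` emb a b ` f \<longleftrightarrow> a = j \<and> b = l \<and> i \<in> fst ` f"
      "j # l # i \<in> fst ` link a b f \<longleftrightarrow> a = j \<and> b = l \<and> i \<in> fst ` f"
      "[j] \<in> fst ` emb a b ` f \<longleftrightarrow> False"
      "[j] \<in> fst ` link a b f \<longleftrightarrow> a = j" for j l i a b f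
    unfolding link_def emb_def by (auto simp: image_iff)
  have E'_filter: "{e\<in>E'. P e} = (\<Union>j<s. \<Union>l<k. (`) (emb j l) ` {e\<in>E. P (emb j l ` e)} \<union>
      link j l ` {f\<in>F. P (link j l f)})" for P
    unfolding E'_def by blast
  have F'card: "card F' \<le> (t - k) ^ s"
    using card_box_le[of "{..<s}" "\<lambda>_. {k..<t}"] by (simp add: F'_def)
  have finI': "finite I'" using fin by (simp add: I'_def)
  have finE': "finite E'" using fin by (simp add: E'_def)
  have I'card: "card I' \<le> s * (1 + k * card I)"
  proof -
    have "card I' \<le> card ((\<lambda>j. [j]) ` {..<s}) + card ((\<lambda>(j, l, i). j # l # i) ` ({..<s} \<times> {..<k} \<times> I))"
      unfolding I'_def by (rule card_Un_le)
    also have "\<dots> \<le> card {..<s} + card ({..<s} \<times> {..<k} \<times> I)"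
      by (intro add_mono card_image_le) (use fin in auto)
    finally show ?thesis by (simp add: card_cartesian_product algebra_simps)
  qed
  have E'pt: "E' \<subseteq> partial_transversals r I' t"
  proof
    fix e assume "e \<in> E'"
    then obtain j l where jl: "j < s" "l < k" and e: "e \<in> (`) (emb j l) ` E \<union> link j l ` F"
      unfolding E'_def by auto
    have sub: "emb j l ` f \<subseteq> I' \<times> {..<t}" "card (emb j l ` f) = card f" "inj_on fst (emb j l ` f)"
      if "f \<subseteq> I \<times> {..<t}" "inj_on fst f" for f
    proof -
      show "emb j l ` f \<subseteq> I' \<times> {..<t}"
        using that jl unfolding I'_def emb_def by (fastforce simp: image_iff)
      show "card (emb j l ` f) = card f"
        using emb_inj by (intro card_image) (auto simp: inj_on_def)
      show "inj_on fst (emb j l ` f)"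
        using that unfolding emb_def by (fastforce simp: inj_on_def)
    qed
    from e show "e \<in> partial_transversals r I' t"
    proof
      assume "e \<in> (`) (emb j l) ` E"
      then obtain f where "f \<in> E" "e = emb j l ` f" by auto
      with EF sub[of f] show ?thesis unfolding partial_transversals_def by auto
    next
      assume "e \<in> link j l ` F"
      then obtain f where f: "f \<in> F" "e = link j l f" by auto
      then have f': "f \<subseteq> I \<times> {..<t}" "inj_on fst f" "card f = s"
        using EF unfolding partial_transversals_def by auto
      \<comment> \<open>The default value of \<open>card\<close> on infinite sets is 0, so s > 0
        forces finiteness.\<close>
      then have "finite f" using s(2) card.infinite by fastforce
      moreover have "([j], l) \<notin> emb j l ` f" "[j] \<notin> fst ` emb j l ` f"
        by (auto simp: emb_def)
      moreover have "([j], l) \<in> I' \<times> {..<t}" using jl k by (auto simp: I'_def)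
      ultimately show ?thesis using sub[OF f'(1,2)] f'(3) s
        unfolding f(2) link_def partial_transversals_def by auto
    qed
  qed
  have F'pt: "F' \<subseteq> partial_transversals (r - 1) I' t"
    using box_subset_partial_transversals[of "{..<s}" I' "\<lambda>_. {k..<t}" t]
    unfolding F'_def s_def I'_def by fastforce
  have touch': "real (card {e\<in>E'. i \<in> fst ` e} + card {f\<in>F'. i \<in> fst ` f}) \<le> K" if "i \<in> I'" for i
  proof -
    consider (root) j where "i = [j]" "j < s"
      | (copy) j l i' where "i = j # l # i'" "j < s" "l < k" "i' \<in> I"
      using \<open>i \<in> I'\<close> unfolding I'_def by auto
    then show ?thesis
    proof cases
      case root
      \<comment> \<open>A root block is met by the completed links of its k treated vertices and
        possibly by all new links; the hypothesis on \<open>K\<close> bounds exactly this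
        sum.\<close>
      have "{e\<in>E'. i \<in> fst ` e} \<subseteq> (\<Union>l<k. link j l ` F)"
        unfolding E'_filter root emb_touch by blast
      then have "card {e\<in>E'. i \<in> fst ` e} \<le> card (\<Union>l<k. link j l ` F)"
        by (rule card_mono[rotated]) (use fin in auto)
      also have "\<dots> \<le> (\<Sum>l<k. card (link j l ` F))"
        by (rule card_UN_le) simp
      also have "\<dots> \<le> (\<Sum>l<k. card F)"
        by (intro sum_mono card_image_le fin)
      finally have 1: "card {e\<in>E'. i \<in> fst ` e} \<le> k * card F" by simp
      have "card {f\<in>F'. i \<in> fst ` f} \<le> card F'"
        by (rule card_mono) (auto simp: F'_def intro!: finite_box)
      with 1 F'card have "card {e\<in>E'. i \<in> fst ` e} + card {f\<in>F'. i \<in> fst ` f} \<le> k * card F + (t - k) ^ s"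
        by linarith
      then have "real (card {e\<in>E'. i \<in> fst ` e} + card {f\<in>F'. i \<in> fst ` f}) \<le> real (k * card F + (t - k) ^ s)"
        by (rule of_nat_mono)
      then show ?thesis using K by (simp add: s_def)
    next
      case copy
      \<comment> \<open>A block of a copy sees only that copy. Its links were already counted by
        \<open>blocker\<close>, so turning them into edges leaves the old bound intact.\<close>
      have "{e\<in>E'. i \<in> fst ` e} \<subseteq>
          (`) (emb j l) ` {e\<in>E. i' \<in> fst ` e} \<union> link j l ` {f\<in>F. i' \<in> fst ` f}"
        unfolding E'_filter copy emb_touch by blast
      then have "card {e\<in>E'. i \<in> fst ` e} \<le>
          card ((`) (emb j l) ` {e\<in>E. i' \<in> fst ` e} \<union> link j l ` {f\<in>F. i' \<in> fst ` f})"
        by (rule card_mono[rotated]) (use fin in auto)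
      also have "\<dots> \<le> card ((`) (emb j l) ` {e\<in>E. i' \<in> fst ` e}) + card (link j l ` {f\<in>F. i' \<in> fst ` f})"
        by (rule card_Un_le)
      also have "\<dots> \<le> card {e\<in>E. i' \<in> fst ` e} + card {f\<in>F. i' \<in> fst ` f}"
        by (intro add_mono card_image_le) (use fin in auto)
      finally have "card {e\<in>E'. i \<in> fst ` e} \<le> \<dots>" .
      moreover have "{f\<in>F'. i \<in> fst ` f} = {}"
        unfolding F'_def copy using box_vertexD by fastforce
      ultimately show ?thesis using touch[OF copy(4)]
        by (simp only: card.empty add_0_right)
    qed
  qed
  have deg': "real (card {e\<in>E'. v \<in> e} + card {f\<in>F'. v \<in> f}) \<le> \<Delta>" if vI: "v \<in> I' \<times> {..<t}" for v
  proof -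
    consider (root) j l where "v = ([j], l)" "j < s" "l < t"
      | (copy) j l v' where "v = emb j l v'" "j < s" "l < k" "v' \<in> I \<times> {..<t}"
    proof -
      obtain i x where v: "v = (i, x)" "x < t" and "i \<in> I'"
        using vI by auto
      then consider (root) j where "i = [j]" "j < s"
        | (copy) j l i' where "i = j # l # i'" "j < s" "l < k" "i' \<in> I"
        unfolding I'_def by auto
      then show thesis
      proof cases
        case root
        then show thesis using that(1) v by blast
      next
        case copy
        then show thesis using that(2)[of j l "(i', x)"] v by (simp add: emb_def)
      qed
    qed
    then show ?thesis
    proof cases
      case root
      have sub: "{e\<in>E'. v \<in> e} \<subseteq> (if l < k then link j l ` F else {})"
        unfolding E'_filter root emb_mem by auto
      \<comment> \<open>A treated vertex lies in at most \<open>card F\<close> edges and in no new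
        link. An untreated one lies in no edge and in at most (t - k)^(r - 2) new links; cancelling
        t - k is legitimate because l itself witnesses k < t.\<close>
      show ?thesis
      proof (cases "l < k")
        case True
        have "card {e\<in>E'. v \<in> e} \<le> card (link j l ` F)"
          using sub True by (intro card_mono) (use fin in auto)
        also have "\<dots> \<le> card F" by (intro card_image_le fin)
        finally have "card {e\<in>E'. v \<in> e} \<le> card F" .
        moreover have "{f\<in>F'. v \<in> f} = {}"
          unfolding F'_def root by (rule box_mem_empty) (use True in auto)
        ultimately show ?thesis using F
          by (simp only: card.empty add_0_right)
      next
        case False
        then have E0: "{e\<in>E'. v \<in> e} = {}" using sub by auto
        have "card {f\<in>F'. v \<in> f} * (t - k) \<le> (t - k) ^ s"
          using box_degree_le[of "{..<s}" "\<lambda>_. {k..<t}" j l] root unfolding F'_def by simp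
        also have "(t - k) ^ s = (t - k) ^ (s - 1) * (t - k)"
          using s by (metis Suc_pred' mult.commute power_Suc)
        finally have "card {f\<in>F'. v \<in> f} \<le> (t - k) ^ (s - 1)"
          using False root by simp
        also have "\<dots> \<le> t ^ (s - 1)" by (intro power_mono) auto
        finally have "card {f\<in>F'. v \<in> f} \<le> t ^ (r - 2)" using s by (simp add: numeral_2_eq_2)
        then have "real (card {f\<in>F'. v \<in> f}) \<le> real t ^ (r - 2)"
          by (metis of_nat_mono of_nat_power)
        then show ?thesis using E0 \<Delta> by (simp only: card.empty add_0_left)
      qed
    next
      case copy
      have "{e\<in>E'. v \<in> e} \<subseteq>
          (`) (emb j l) ` {e\<in>E. v' \<in> e} \<union> link j l ` {f\<in>F. v' \<in> f}"
        unfolding E'_filter copy emb_mem by blast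
      then have "card {e\<in>E'. v \<in> e} \<le>
          card ((`) (emb j l) ` {e\<in>E. v' \<in> e} \<union> link j l ` {f\<in>F. v' \<in> f})"
        by (rule card_mono[rotated]) (use fin in auto)
      also have "\<dots> \<le> card ((`) (emb j l) ` {e\<in>E. v' \<in> e}) + card (link j l ` {f\<in>F. v' \<in> f})"
        by (rule card_Un_le)
      also have "\<dots> \<le> card {e\<in>E. v' \<in> e} + card {f\<in>F. v' \<in> f}"
        by (intro add_mono card_image_le) (use fin in auto)
      finally have "card {e\<in>E'. v \<in> e} \<le> \<dots>" .
      moreover have "{f\<in>F'. v \<in> f} = {}"
        unfolding F'_def copy emb_def using box_vertexD by fastforce
      ultimately show ?thesis using deg[OF copy(4)]
        by (simp only: card.empty add_0_right)
    qed
  qed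
  \<comment> \<open>If \<open>T\<close> avoids all treated vertices, its root choices form a new
    link. Otherwise it picks a treated vertex l of some root block j, and the edge or link forced
    inside copy (j, l) yields an edge, completed by \<open>([j], l)\<close> in the case of a
    link.\<close>
  have noT': "\<exists>e\<in>E' \<union> F'. \<forall>v\<in>e. T (fst v) = snd v" if T: "T \<in> I' \<rightarrow> {..<t}" for T
  proof (cases "\<forall>j<s. k \<le> T [j]")
    case True
    have "T [j] \<in> {k..<t}" if "j \<in> {..<s}" for j
      using True T that unfolding I'_def by auto
    then show ?thesis using box_intro[of "{..<s}" T "\<lambda>_. {k..<t}"] unfolding F'_def by blast
  next
    case False
    then obtain j where j: "j < s" "T [j] < k" by force
    define l where "l = T [j]"
    have "(\<lambda>i. T (j # l # i)) \<in> I \<rightarrow> {..<t}"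
    proof
      fix i assume "i \<in> I"
      then have "(j, l, i) \<in> {..<s} \<times> {..<k} \<times> I" using j by (simp add: l_def)
      then have "j # l # i \<in> I'" unfolding I'_def by force
      then show "T (j # l # i) \<in> {..<t}" using T by auto
    qed
    from noT[OF this] obtain e where e: "e \<in> E \<union> F" "\<forall>v\<in>e. T (j # l # fst v) = snd v" by auto
    have "\<forall>v\<in>emb j l ` e. T (fst v) = snd v" "\<forall>v\<in>link j l e. T (fst v) = snd v"
      using e(2) by (auto simp: emb_def link_def l_def)
    moreover have "e \<in> E \<Longrightarrow> emb j l ` e \<in> E'" "e \<in> F \<Longrightarrow> link j l e \<in> E'"
      using j unfolding E'_def l_def by blast+
    ultimately show ?thesis using e(1) by blast
  qed
  have "blocker r t K \<Delta> I' E' F'"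
    unfolding blocker_def using finI' E'pt F'pt touch' deg' noT' by blast
  then show ?thesis using F'card I'card unfolding s_def by blast
qed

section \<open>The initial gadget\<close>

text \<open>The overlap of the two link conditions is traded for edges: p and t - 2 p add up to only
  t - p link parts. The inequality 2 p + 1 \<le> t - p then keeps every degree below the largest
  one, (t - p) t^(r - 2), attained as a bound on the first 2 p vertices of block 1.\<close>

lemma blocker_base:
  assumes r: "r \<ge> 2" and p: "p > 0" "3 * p + 1 \<le> t"
    and K: "real ((2 * p + 1) * (t - p) * t ^ (r - 2)) \<le> K"
    and \<Delta>: "real ((t - p) * t ^ (r - 2)) \<le> \<Delta>"
  shows "\<exists>I :: nat list set. \<exists>E F. blocker r t K \<Delta> I E F \<and>
    card F \<le> (t - p) * t ^ (r - 2) \<and> card I = r"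
proof -
  define N where "N = t ^ (r - 2)"
  define I where "I = (\<lambda>j. [j :: nat]) ` {..<r}"
  \<comment> \<open>\<open>A\<close> spans the edges. \<open>B\<close> gives links that omit block 1
    and catch choices below p in block 0; \<open>C\<close> gives links that omit block 0 and catch
    choices from 2 p on in block 1.\<close>
  define A B C :: "nat \<Rightarrow> nat set" where
    "A = (\<lambda>i. if i = 0 then {p..<t} else if i = 1 then {..<2 * p} else {..<t})" and
    "B = (\<lambda>i. if i = 0 then {..<p} else {..<t})" and
    "C = (\<lambda>i. if i = 1 then {2 * p..<t} else {..<t})"
  define E where "E = box {..<r} A"
  define F\<^sub>0 where "F\<^sub>0 = box ({..<r} - {1}) B"
  define F\<^sub>1 where "F\<^sub>1 = box ({..<r} - {0}) C"
  have cI: "card I = r" unfolding I_def by (subst card_image) (auto simp: inj_on_def)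
  have sub: "A i \<subseteq> {..<t}" "B i \<subseteq> {..<t}" "C i \<subseteq> {..<t}" for i
    unfolding A_def B_def C_def using p by auto
  then have finA: "finite (A i)" "finite (B i)" "finite (C i)" for i
    using finite_subset finite_lessThan by metis+
  have fin: "finite E" "finite F\<^sub>0" "finite F\<^sub>1"
    unfolding E_def F\<^sub>0_def F\<^sub>1_def using finA by (auto intro!: finite_box)
  have card_rest: "card ({..<r} - {0} - {1}) = r - 2" "card ({..<r} - {1} - {0}) = r - 2"
    using r by (auto simp: card_Diff_singleton)
  have prodA: "(\<Prod>i<r. card (A i)) = (t - p) * (2 * p * N)"
  proof -
    have "(\<Prod>i<r. card (A i)) = card (A 0) * (card (A 1) * (\<Prod>i\<in>{..<r} - {0} - {1}. card (A i)))"
      using r by (subst prod.remove[of _ 0], simp, simp, subst prod.remove[of _ 1]) auto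
    also have "(\<Prod>i\<in>{..<r} - {0} - {1}. card (A i)) = (\<Prod>i\<in>{..<r} - {0} - {1}. t)"
      by (rule prod.cong) (auto simp: A_def)
    finally show ?thesis using card_rest unfolding N_def by (simp add: A_def)
  qed
  have prodB: "(\<Prod>i\<in>{..<r} - {1}. card (B i)) = p * N"
  proof -
    have "(\<Prod>i\<in>{..<r} - {1}. card (B i)) = card (B 0) * (\<Prod>i\<in>{..<r} - {1} - {0}. card (B i))"
      using r by (subst prod.remove[of _ 0]) auto
    also have "(\<Prod>i\<in>{..<r} - {1} - {0}. card (B i)) = (\<Prod>i\<in>{..<r} - {1} - {0}. t)"
      by (rule prod.cong) (auto simp: B_def)
    finally show ?thesis using card_rest unfolding N_def by (simp add: B_def)
  qed
  have prodC: "(\<Prod>i\<in>{..<r} - {0}. card (C i)) = (t - 2 * p) * N"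
  proof -
    have "(\<Prod>i\<in>{..<r} - {0}. card (C i)) = card (C 1) * (\<Prod>i\<in>{..<r} - {0} - {1}. card (C i))"
      using r by (subst prod.remove[of _ 1]) auto
    also have "(\<Prod>i\<in>{..<r} - {0} - {1}. card (C i)) = (\<Prod>i\<in>{..<r} - {0} - {1}. t)"
      by (rule prod.cong) (auto simp: C_def)
    finally show ?thesis using card_rest unfolding N_def by (simp add: C_def)
  qed
  have cE: "card E \<le> (t - p) * (2 * p * N)"
    using card_box_le[of "{..<r}" A] finA prodA unfolding E_def by simp
  have cF: "card (F\<^sub>0 \<union> F\<^sub>1) \<le> (t - p) * N"
  proof -
    have "card F\<^sub>0 \<le> p * N" "card F\<^sub>1 \<le> (t - 2 * p) * N"
      using card_box_le[of "{..<r} - {1}" B] card_box_le[of "{..<r} - {0}" C] finA prodB prodC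
      unfolding F\<^sub>0_def F\<^sub>1_def by simp_all
    then have "card F\<^sub>0 + card F\<^sub>1 \<le> (p + (t - 2 * p)) * N"
      by (simp add: add_mult_distrib)
    moreover have "p + (t - 2 * p) = t - p" using p by simp
    ultimately show ?thesis using card_Un_le[of F\<^sub>0 F\<^sub>1] by simp
  qed
  have touch: "real (card {e\<in>E. i \<in> fst ` e} + card {f\<in>F\<^sub>0 \<union> F\<^sub>1. i \<in> fst ` f}) \<le> K" for i
  proof -
    have "card {e\<in>E. i \<in> fst ` e} \<le> card E" "card {f\<in>F\<^sub>0 \<union> F\<^sub>1. i \<in> fst ` f} \<le> card (F\<^sub>0 \<union> F\<^sub>1)"
      using fin by (auto intro!: card_mono)
    then have "card {e\<in>E. i \<in> fst ` e} + card {f\<in>F\<^sub>0 \<union> F\<^sub>1. i \<in> fst ` f} \<le> (2 * p + 1) * (t - p) * N"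
      using cE cF by (simp add: algebra_simps)
    then show ?thesis using K unfolding N_def by (meson of_nat_mono order_trans)
  qed
  have deg: "real (card {e\<in>E. v \<in> e} + card {f\<in>F\<^sub>0 \<union> F\<^sub>1. v \<in> f}) \<le> \<Delta>" if vI: "v \<in> I \<times> {..<t}" for v
  proof -
    obtain j x where v: "v = ([j], x)" "j < r" "x < t"
      using vI unfolding I_def by auto
    define d where "d = card {e\<in>E. v \<in> e}"
    define d\<^sub>0 where "d\<^sub>0 = card {f\<in>F\<^sub>0. v \<in> f}"
    define d\<^sub>1 where "d\<^sub>1 = card {f\<in>F\<^sub>1. v \<in> f}"
    have "{f\<in>F\<^sub>0 \<union> F\<^sub>1. v \<in> f} = {f\<in>F\<^sub>0. v \<in> f} \<union> {f\<in>F\<^sub>1. v \<in> f}" by auto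
    then have dF: "card {f\<in>F\<^sub>0 \<union> F\<^sub>1. v \<in> f} \<le> d\<^sub>0 + d\<^sub>1"
      unfolding d\<^sub>0_def d\<^sub>1_def by (simp add: card_Un_le)
    have d_bound: "d * card (A j) \<le> (t - p) * (2 * p * N)"
      using box_degree_le[of "{..<r}" A j x] finA v prodA unfolding d_def E_def by simp
    have d\<^sub>0_bound: "d\<^sub>0 * card (B j) \<le> p * N" if "j \<noteq> 1"
      using box_degree_le[of "{..<r} - {1}" B j x] finA v prodB that unfolding d\<^sub>0_def F\<^sub>0_def by simp
    have d\<^sub>1_bound: "d\<^sub>1 * card (C j) \<le> (t - 2 * p) * N" if "j \<noteq> 0"
      using box_degree_le[of "{..<r} - {0}" C j x] finA v prodC that unfolding d\<^sub>1_def F\<^sub>1_def by simp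
    have pN: "(2 * p + 1) * N \<le> (t - p) * N"
      using p by (intro mult_right_mono) auto
    \<comment> \<open>Blocks 0 and 1 carry the restricted parts. In block 1 edges and links use
      complementary vertices, so their degrees do not add up there.\<close>
    consider "j = 0" | "j = 1" "x < 2 * p" | "j = 1" "x \<ge> 2 * p" | "j \<ge> 2" by linarith
    then have "d + d\<^sub>0 + d\<^sub>1 \<le> (t - p) * N"
    proof cases
      case 1
      have "d * (t - p) \<le> 2 * p * N * (t - p)"
        using d_bound 1 by (simp add: A_def mult.commute)
      then have "d \<le> 2 * p * N" using p by (simp only: mult_le_cancel2; auto)
      moreover have "d\<^sub>0 \<le> N" using d\<^sub>0_bound 1 p by (simp add: B_def)
      moreover have "d\<^sub>1 = 0"
        unfolding d\<^sub>1_def F\<^sub>1_def v by (subst box_mem_empty) (use 1 in \<open>simp_all\<close>)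
      ultimately show ?thesis using pN by (simp add: algebra_simps)
    next
      case 2
      have "d * (2 * p) \<le> (t - p) * N * (2 * p)"
        using d_bound 2 by (simp add: A_def mult_ac)
      then have "d \<le> (t - p) * N" using p by (simp only: mult_le_cancel2; auto)
      moreover have "d\<^sub>0 = 0"
        unfolding d\<^sub>0_def F\<^sub>0_def v by (subst box_mem_empty) (use 2 in \<open>simp_all\<close>)
      moreover have "d\<^sub>1 = 0"
        unfolding d\<^sub>1_def F\<^sub>1_def v by (subst box_mem_empty) (use 2 in \<open>simp_all add: C_def\<close>)
      ultimately show ?thesis by simp
    next
      case 3
      have "d\<^sub>1 * (t - 2 * p) \<le> N * (t - 2 * p)"
        using d\<^sub>1_bound 3 by (simp add: C_def mult.commute)
      then have "d\<^sub>1 \<le> N" using p by (simp only: mult_le_cancel2; auto)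
      moreover have "d\<^sub>0 = 0"
        unfolding d\<^sub>0_def F\<^sub>0_def v by (subst box_mem_empty) (use 3 in \<open>simp_all\<close>)
      moreover have "d = 0"
        unfolding d_def E_def v by (subst box_mem_empty) (use 3 in \<open>simp_all add: A_def\<close>)
      moreover have "N \<le> (t - p) * N" using p by auto
      ultimately show ?thesis by linarith
    next
      case 4
      \<comment> \<open>In the remaining blocks all t vertices share edges and links evenly, so the
        three bounds are added before dividing by t.\<close>
      have "d * t \<le> (t - p) * (2 * p * N)" "d\<^sub>0 * t \<le> p * N" "d\<^sub>1 * t \<le> (t - 2 * p) * N"
        using d_bound d\<^sub>0_bound d\<^sub>1_bound 4 by (simp_all add: A_def B_def C_def)
      then have "(d + d\<^sub>0 + d\<^sub>1) * t \<le> (t - p) * (2 * p * N) + (p + (t - 2 * p)) * N"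
        by (simp add: add_mult_distrib)
      also have "p + (t - 2 * p) = t - p" using p by simp
      also have "(t - p) * (2 * p * N) + (t - p) * N = (t - p) * ((2 * p + 1) * N)"
        by (simp add: algebra_simps)
      also have "\<dots> \<le> (t - p) * (t * N)"
        by (intro mult_left_mono mult_right_mono) (use p in auto)
      finally have "(d + d\<^sub>0 + d\<^sub>1) * t \<le> (t - p) * N * t" by (simp add: mult_ac)
      then show ?thesis using p by (simp only: mult_le_cancel2; auto)
    qed
    then have "card {e\<in>E. v \<in> e} + card {f\<in>F\<^sub>0 \<union> F\<^sub>1. v \<in> f} \<le> (t - p) * N"
      using dF unfolding d_def by linarith
    then show ?thesis using \<Delta> unfolding N_def by (meson of_nat_mono order_trans)
  qed
  have noT: "\<exists>e\<in>E \<union> (F\<^sub>0 \<union> F\<^sub>1). \<forall>v\<in>e. T (fst v) = snd v" if T: "T \<in> I \<rightarrow> {..<t}" for T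
  proof -
    have Tt: "T [j] < t" if "j < r" for j using T that unfolding I_def by auto
    consider "T [0] < p" | "T [1] \<ge> 2 * p" | "T [0] \<ge> p" "T [1] < 2 * p" by linarith
    then show ?thesis
    proof cases
      case 1
      then have "\<exists>e\<in>F\<^sub>0. \<forall>v\<in>e. T (fst v) = snd v"
        unfolding F\<^sub>0_def using Tt by (intro box_intro) (auto simp: B_def)
      then show ?thesis by blast
    next
      case 2
      then have "\<exists>e\<in>F\<^sub>1. \<forall>v\<in>e. T (fst v) = snd v"
        unfolding F\<^sub>1_def using Tt by (intro box_intro) (auto simp: C_def)
      then show ?thesis by blast
    next
      case 3
      then have "\<exists>e\<in>E. \<forall>v\<in>e. T (fst v) = snd v"
        unfolding E_def using Tt by (intro box_intro) (auto simp: A_def)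
      then show ?thesis by blast
    qed
  qed
  have "E \<subseteq> partial_transversals r I t"
    using box_subset_partial_transversals[of "{..<r}" I A t] sub unfolding E_def I_def by fastforce
  moreover have "F\<^sub>0 \<subseteq> partial_transversals (r - 1) I t"
    using box_subset_partial_transversals[of "{..<r} - {1}" I B t] sub r
    unfolding F\<^sub>0_def I_def by (fastforce simp: card_Diff_singleton)
  moreover have "F\<^sub>1 \<subseteq> partial_transversals (r - 1) I t"
    using box_subset_partial_transversals[of "{..<r} - {0}" I C t] sub r
    unfolding F\<^sub>1_def I_def by (fastforce simp: card_Diff_singleton)
  moreover have "finite I" by (simp add: I_def)
  ultimately have "blocker r t K \<Delta> I E (F\<^sub>0 \<union> F\<^sub>1)"
    unfolding blocker_def using touch deg noT by (intro conjI ballI Un_least) auto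
  then show ?thesis using cF cI unfolding N_def by blast
qed

section \<open>Iterating the round until few links remain\<close>

text \<open>Each round treats k = t - (a - q) vertices, which lowers the bound a^(r - 1) on the
  number of links to (a - q)^(r - 1). The hypothesis on \<open>K\<close> is the cost of one such
  round.\<close>

lemma blocker_iterate:
  assumes r: "r \<ge> 2" and t: "2 * r \<le> t"
    and start: "blocker r t K \<Delta> (I :: nat list set) E F" "card F \<le> b ^ (r - 1)" "card I \<le> t ^ 3"
    and b: "b \<le> t" "real b ^ (r - 1) \<le> \<Delta>" and \<Delta>: "real t ^ (r - 2) \<le> \<Delta>"
    and K: "\<And>a. a \<le> b \<Longrightarrow> (real t - real (a - q)) * real a ^ (r - 1) + real (a - q) ^ (r - 1) \<le> K"
  shows "\<exists>I :: nat list set. \<exists>E F. blocker r t K \<Delta> I E F \<and>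
    card F \<le> (b - m * q) ^ (r - 1) \<and> card I \<le> t ^ (2 * m + 3)"
proof (induction m)
  case 0
  show ?case using start by auto
next
  case (Suc m)
  then obtain I :: "nat list set" and E F where bl: "blocker r t K \<Delta> I E F"
    and F: "card F \<le> (b - m * q) ^ (r - 1)" and I: "card I \<le> t ^ (2 * m + 3)" by blast
  define a where "a = b - m * q"
  define k where "k = t - (a - q)"
  have ab: "a \<le> b" by (simp add: a_def)
  have k: "k \<le> t" "t - k = a - q" "real k = real t - real (a - q)"
    using ab b by (auto simp: k_def of_nat_diff)
  have Fa: "real (card F) \<le> real a ^ (r - 1)"
    using F unfolding a_def by (metis of_nat_mono of_nat_power)
  also have "\<dots> \<le> real b ^ (r - 1)" using ab by (intro power_mono) auto
  finally have F\<Delta>: "real (card F) \<le> \<Delta>" using b by linarith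
  have "real k * real (card F) + real (t - k) ^ (r - 1) \<le> real k * real a ^ (r - 1) + real (t - k) ^ (r - 1)"
    using Fa by (intro add_mono mult_left_mono) auto
  also have "\<dots> \<le> K" using K[OF ab] k by simp
  finally obtain I' :: "nat list set" and E' F' where bl': "blocker r t K \<Delta> I' E' F'"
    and F': "card F' \<le> (t - k) ^ (r - 1)" and I': "card I' \<le> (r - 1) * (1 + k * card I)"
    using blocker_step[OF bl r k(1) F\<Delta> \<Delta>] by blast
  \<comment> \<open>Truncated subtraction lets the parameter stay at 0 once it has got
    there.\<close>
  have "t - k = b - Suc m * q" unfolding k(2) a_def by simp
  moreover have "card I' \<le> t ^ (2 * Suc m + 3)"
  \<comment> \<open>A round multiplies the bound on the number of blocks by at most 2 (r - 1) t
    \<le> t^2; hence the 2 in the exponent and the assumption 2 r \<le> t.\<close>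
  proof -
    let ?N = "t ^ (2 * m + 3)"
    have "1 \<le> t * ?N" using r t by simp
    moreover have "k * card I \<le> t * ?N" using k I by (intro mult_mono) auto
    ultimately have "1 + k * card I \<le> 2 * (t * ?N)" by linarith
    then have "(r - 1) * (1 + k * card I) \<le> (r - 1) * (2 * (t * ?N))"
      by (rule mult_left_mono) simp
    also have "\<dots> = (2 * (r - 1)) * (t * ?N)" by simp
    also have "\<dots> \<le> t * (t * ?N)" by (rule mult_right_mono) (use t in auto)
    finally show ?thesis using I' by (simp add: numeral_eq_Suc)
  qed
  ultimately show ?case using bl' F' by metis
qed

section \<open>From a gadget without links to a hypergraph on natural numbers\<close>

text \<open>Without links, the last clause of \<open>blocker\<close> says that every choice of one
  vertex per block contains an edge. Vertices are coded by \<open>to_nat\<close>.\<close>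

lemma ex_hypergraph_of_blocker:
  fixes I :: "'i::countable set"
  assumes bl: "blocker r t K \<Delta> I E {}" and inf: "infinite (UNIV :: 'i set)"
    and t: "t > 0" and K: "K \<ge> 0" and \<Delta>: "\<Delta> \<ge> 0" and n: "card I \<le> n"
  shows "\<exists>(V :: nat set) E P. uniform_hypergraph r V E \<and>
    partition_on V P \<and> card P = n \<and> thick t P \<and> (\<forall>e\<in>E. stretched P e) \<and>
    (\<forall>B\<in>P. real (card {e \<in> E. e \<inter> B \<noteq> {}}) \<le> K) \<and>
    (\<forall>v\<in>V. real (degree E v) \<le> \<Delta>) \<and>
    \<not> (\<exists>T. independent_transversal V E P T)"
proof -
  define h :: "'i \<times> nat \<Rightarrow> nat" where "h = to_nat"
  have h: "h u = h v \<longleftrightarrow> u = v" for u v unfolding h_def by simp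
  note fin = blocker_finite[OF bl]
  have E: "E \<subseteq> partial_transversals r I t"
    and touch: "\<And>i. i \<in> I \<Longrightarrow> real (card {e\<in>E. i \<in> fst ` e}) \<le> K"
    and deg: "\<And>v. v \<in> I \<times> {..<t} \<Longrightarrow> real (card {e\<in>E. v \<in> e}) \<le> \<Delta>"
    and noT: "\<And>T. T \<in> I \<rightarrow> {..<t} \<Longrightarrow> \<exists>e\<in>E. \<forall>v\<in>e. T (fst v) = snd v"
    using bl unfolding blocker_def by auto
  \<comment> \<open>Fresh blocks that meet no edge pad the partition to exactly n blocks.
    Nonnegativity of \<open>K\<close> and \<Delta> settles the bounds on them.\<close>
  have "infinite (- I)" using inf fin by (metis Compl_eq_Diff_UNIV Diff_infinite_finite)
  then obtain I' where I': "finite I'" "card I' = n - card I" "I' \<subseteq> - I"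
    using infinite_arbitrarily_large by blast
  define J where "J = I \<union> I'"
  have J: "finite J" "I \<subseteq> J" "card J = n"
    using I' fin n unfolding J_def by (auto, subst card_Un_disjoint) auto
  define blk where "blk = (\<lambda>i. h ` ({i} \<times> {..<t}))"
  define V where "V = h ` (J \<times> {..<t})"
  define E' where "E' = (`) h ` E"
  define P where "P = blk ` J"
  have h_blk: "h v \<in> blk i \<longleftrightarrow> fst v = i \<and> snd v < t" for v i
    unfolding blk_def by (cases v) (auto simp: h)
  have h_inj: "inj_on h A" for A by (auto simp: inj_on_def h)
  have e_sub: "e \<subseteq> I \<times> {..<t}" "card e = r" "inj_on fst e" if "e \<in> E" for e
    using that E unfolding partial_transversals_def by auto
  have "uniform_hypergraph r V E'"
    unfolding uniform_hypergraph_def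
  proof (intro conjI ballI)
    show "finite V" using J by (simp add: V_def)
    fix e assume "e \<in> E'"
    then obtain f where f: "f \<in> E" "e = h ` f" by (auto simp: E'_def)
    show "e \<subseteq> V" using e_sub[OF f(1)] J unfolding f V_def by fastforce
    show "card e = r" unfolding f using e_sub[OF f(1)] by (simp add: card_image h_inj)
  qed
  moreover have "partition_on V P"
  proof (rule partition_onI)
    show "\<Union> P = V" unfolding P_def V_def blk_def by auto
    show "disjnt p q" if "p \<in> P" "q \<in> P" "p \<noteq> q" for p q
      using that unfolding P_def blk_def disjnt_def by (auto simp: h)
    show "{} \<notin> P" using t unfolding P_def blk_def by auto
  qed
  moreover have "card P = n"
  proof -
    have "inj_on blk J"
    proof (rule inj_onI)
      fix i j assume "blk i = blk j"
      then have "h (i, 0) \<in> blk j" using t h_blk[of "(i, 0)" i] by simp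
      then show "i = j" by (simp add: h_blk)
    qed
    then show ?thesis unfolding P_def using J by (simp add: card_image)
  qed
  moreover have "thick t P"
    unfolding thick_def P_def blk_def by (auto simp: card_image h_inj)
  moreover have "\<forall>e\<in>E'. stretched P e"
    using e_sub(3) unfolding E'_def stretched_def P_def by (auto simp: h_blk h inj_on_def)
  moreover have "\<forall>B\<in>P. real (card {e \<in> E'. e \<inter> B \<noteq> {}}) \<le> K"
  proof
    fix B assume "B \<in> P"
    then obtain i where i: "i \<in> J" "B = blk i" by (auto simp: P_def)
    have "{e \<in> E'. e \<inter> B \<noteq> {}} \<subseteq> (`) h ` {e\<in>E. i \<in> fst ` e}"
    proof
      fix e assume "e \<in> {e \<in> E'. e \<inter> B \<noteq> {}}"
      then obtain f v where f: "f \<in> E" "e = h ` f" "v \<in> f" "h v \<in> blk i"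
        unfolding E'_def i by auto
      then have "i \<in> fst ` f" by (auto simp: h_blk)
      then show "e \<in> (`) h ` {e\<in>E. i \<in> fst ` e}" using f by simp
    qed
    then have "card {e \<in> E'. e \<inter> B \<noteq> {}} \<le> card ((`) h ` {e\<in>E. i \<in> fst ` e})"
      by (rule card_mono[rotated]) (use fin in auto)
    also have "\<dots> \<le> card {e\<in>E. i \<in> fst ` e}" by (rule card_image_le) (use fin in auto)
    finally have le: "card {e \<in> E'. e \<inter> B \<noteq> {}} \<le> card {e\<in>E. i \<in> fst ` e}" .
    show "real (card {e \<in> E'. e \<inter> B \<noteq> {}}) \<le> K"
    proof (cases "i \<in> I")
      case True
      then show ?thesis using le touch by (meson of_nat_mono order_trans)
    next
      case False
      then have "{e\<in>E. i \<in> fst ` e} = {}" using e_sub(1) by fastforce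
      then show ?thesis using le K by (simp only: card.empty; simp)
    qed
  qed
  moreover have "\<forall>v\<in>V. real (degree E' v) \<le> \<Delta>"
  proof
    fix v assume "v \<in> V"
    then obtain u where u: "u \<in> J \<times> {..<t}" "v = h u" by (auto simp: V_def)
    have "{e \<in> E'. v \<in> e} \<subseteq> (`) h ` {e\<in>E. u \<in> e}"
      unfolding E'_def u by (auto simp: h)
    then have "card {e \<in> E'. v \<in> e} \<le> card ((`) h ` {e\<in>E. u \<in> e})"
      by (rule card_mono[rotated]) (use fin in auto)
    also have "\<dots> \<le> card {e\<in>E. u \<in> e}" by (rule card_image_le) (use fin in auto)
    finally have le: "degree E' v \<le> card {e\<in>E. u \<in> e}" unfolding degree_def .
    show "real (degree E' v) \<le> \<Delta>"
    proof (cases "u \<in> I \<times> {..<t}")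
      case True
      then show ?thesis using le deg by (meson of_nat_mono order_trans)
    next
      case False
      then have "{e\<in>E. u \<in> e} = {}" using e_sub(1) by fastforce
      then show ?thesis using le \<Delta> by (simp only: card.empty; simp)
    qed
  qed
  moreover have "\<not> (\<exists>T. independent_transversal V E' P T)"
  proof
    assume "\<exists>T. independent_transversal V E' P T"
    then obtain T where T: "\<forall>B\<in>P. \<exists>!v. v \<in> T \<inter> B" "\<not> (\<exists>e\<in>E'. e \<subseteq> T)"
      unfolding independent_transversal_def by auto
    \<comment> \<open>An independent transversal is read back as a choice function \<open>S\<close>,
      whose restriction to \<open>I\<close> contains an edge.\<close>
    have "\<exists>x<t. h (i, x) \<in> T" if "i \<in> J" for i
    proof -
      have "blk i \<in> P" using that by (simp add: P_def)
      then obtain v where "v \<in> T \<inter> blk i" using T(1) by blast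
      then show ?thesis unfolding blk_def by auto
    qed
    then obtain S where S: "\<And>i. i \<in> J \<Longrightarrow> S i < t \<and> h (i, S i) \<in> T" by metis
    have "S \<in> I \<rightarrow> {..<t}" using S J by auto
    from noT[OF this] obtain e where e: "e \<in> E" "\<forall>v\<in>e. S (fst v) = snd v" by blast
    have "h v \<in> T" if "v \<in> e" for v
    proof -
      have "v \<in> I \<times> {..<t}" using e_sub(1)[OF e(1)] that by blast
      then have "fst v \<in> J" using J by auto
      then show ?thesis using S[of "fst v"] e(2) that by simp
    qed
    then have "h ` e \<subseteq> T" by auto
    then show False using T(2) e(1) unfolding E'_def by blast
  qed
  ultimately show ?thesis by blast
qed

section \<open>The extremal constant and the choice of parameters\<close>

text \<open>The left side is largest at a = (r - 1) t / r. Bernoulli's inequality replaces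
  calculus.\<close>

lemma diff_mult_power_le:
  fixes a t :: real
  assumes r: "r \<ge> 2" and a: "0 \<le> a" "a \<le> t"
  shows "(t - a) * a ^ (r - 1) \<le> real (r - 1) ^ (r - 1) / real r ^ r * t ^ r"
proof (cases "a = 0")
  case True
  then show ?thesis using r a by (simp add: zero_power)
next
  case False
  obtain s where s: "r = Suc s" "s > 0" using r by (cases r) auto
  have pos: "a > 0" "real r > 0" "real s > 0" using False a r s by auto
  \<comment> \<open>Chosen so that y = 0 at the maximiser; then 1 + r y = (r - 1) (t - a) / a, and
    multiplying Bernoulli's inequality by a^r / (r - 1) gives the claim.\<close>
  define y where "y = t * real s / (real r * a) - 1"
  have "1 + real r * y \<le> (1 + y) ^ r"
    by (rule Bernoulli_inequality) (use pos a in \<open>simp add: y_def\<close>)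
  moreover have "1 + real r * y = real s * (t - a) / a"
  proof -
    have "real r * y = t * real s / a - real r" using pos by (simp add: y_def right_diff_distrib)
    moreover have "real r = real s + 1" using s by simp
    ultimately show ?thesis using pos by (simp add: field_simps)
  qed
  moreover have "(1 + y) ^ r = t ^ r * real s ^ r / (real r ^ r * a ^ r)"
    by (simp add: y_def power_divide power_mult_distrib)
  ultimately have "real s * (t - a) / a \<le> t ^ r * real s ^ r / (real r ^ r * a ^ r)" by simp
  then have "real s * (t - a) / a * (a ^ r / real s) \<le> t ^ r * real s ^ r / (real r ^ r * a ^ r) * (a ^ r / real s)"
    by (rule mult_right_mono) (use pos in simp)
  moreover have "real s * (t - a) / a * (a ^ r / real s) = (t - a) * a ^ s"
    using pos s by simp
  moreover have "t ^ r * real s ^ r / (real r ^ r * a ^ r) * (a ^ r / real s) = real s ^ s / real r ^ r * t ^ r"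
  proof -
    have "real s ^ r = real s * real s ^ s" by (simp add: s)
    then show ?thesis using pos by simp
  qed
  ultimately show ?thesis using s by simp
qed

text \<open>Three stages: the initial gadget, one round with k = p, and \<open>M\<close> rounds that
  each lower the parameter by q.\<close>

lemma ex_blocker_without_links:
  fixes r t M :: nat and \<epsilon> :: real
  defines "c \<equiv> real (r - 1) ^ (r - 1) / real r ^ r"
  assumes r: "r \<ge> 2" and M: "2 / \<epsilon> \<le> real M" and \<epsilon>: "\<epsilon> > 0"
    and t: "2 * r \<le> t" "8 \<le> t" "9 / c \<le> real t" "4 / \<epsilon> \<le> real t"
  shows "\<exists>I :: nat list set. \<exists>E.
    blocker r t ((c + \<epsilon>) * real t ^ r) ((1 - c / 3) * real t ^ (r - 1)) I E {} \<and> card I \<le> t ^ (2 * M + 3)"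
proof -
  define K where "K = (c + \<epsilon>) * real t ^ r"
  define \<Delta> where "\<Delta> = (1 - c / 3) * real t ^ (r - 1)"
  \<comment> \<open>Rounding up gives t - p \<le> (1 - c/3) t for the degrees, while 2 p + 1 \<le> 2
    c t / 3 + 3 \<le> c t for the block budget; the latter needs c t \<ge> 9.\<close>
  define p where "p = nat \<lceil>c * real t / 3\<rceil>"
  \<comment> \<open>The summand 1 ensures \<open>M * q\<close> \<ge> t, so \<open>M\<close> rounds
    suffice, and q \<le> \<epsilon> t / 2 + 1.\<close>
  define q where "q = t div M + 1"
  have c0: "c > 0" using r by (simp add: c_def)
  have c1: "c \<le> 1 / 2"
  proof -
    obtain s where s: "r = Suc s" "s > 0" using r by (cases r) auto
    have "real s ^ s \<le> real r ^ s" using s by (intro power_mono) auto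
    then have "c \<le> real r ^ s / real r ^ r"
      unfolding c_def using s by (intro divide_right_mono) auto
    also have "\<dots> = 1 / real r" using s by simp
    also have "\<dots> \<le> 1 / 2" using r by (intro divide_left_mono) auto
    finally show ?thesis .
  qed
  have t0: "real t > 0" "t > 0" using t by auto
  have M0: "M > 0" using M \<epsilon> by (metis divide_pos_pos less_le_trans of_nat_0_less_iff zero_less_numeral)
  have ct: "c * real t \<ge> 9" using t(3) c0 by (simp add: field_simps)
  have \<epsilon>t: "\<epsilon> * real t \<ge> 4" using t(4) \<epsilon> by (simp add: field_simps)
  have p_bounds: "c * real t / 3 \<le> real p" "real p \<le> c * real t / 3 + 1"
    unfolding p_def using c0 t0 by (auto simp: of_nat_nat intro: ceiling_correct)
  have p0: "p > 0" using p_bounds ct by (cases p) auto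
  \<comment> \<open>From c \<le> 1/2 one gets 3 p + 1 \<le> t / 2 + 4, which is at most t once t
    \<ge> 8.\<close>
  have "c * real t \<le> real t / 2" using c1 t0 by (simp add: field_simps)
  moreover have "real t \<ge> 8" using t(2) by simp
  ultimately have "3 * real p + 1 \<le> real t" using p_bounds by linarith
  then have "real (3 * p + 1) \<le> real t" by simp
  then have p3: "3 * p + 1 \<le> t" by (simp only: of_nat_le_iff)
  have tr: "real t ^ (r - 1) = real t * real t ^ (r - 2)" "real t ^ r = real t * real t ^ (r - 1)"
    using r by (simp_all flip: power_Suc add: Suc_diff_Suc numeral_2_eq_2)
  have large: "x * real t ^ (r - 1) \<le> K" if "x \<le> c * real t" for x
  proof -
    have "x * real t ^ (r - 1) \<le> c * real t * real t ^ (r - 1)"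
      using that by (intro mult_right_mono) auto
    also have "\<dots> = c * real t ^ r" using tr by simp
    also have "\<dots> \<le> K" using \<epsilon> unfolding K_def by (intro mult_right_mono) auto
    finally show ?thesis .
  qed
  have base_F: "real ((t - p) * t ^ (r - 2)) \<le> real t ^ (r - 1)"
    using tr p3 by (simp add: mult_right_mono)
  have base_K: "real ((2 * p + 1) * (t - p) * t ^ (r - 2)) \<le> K"
  proof -
    have "real ((2 * p + 1) * (t - p) * t ^ (r - 2)) = real (2 * p + 1) * real ((t - p) * t ^ (r - 2))"
      by (simp only: of_nat_mult mult.assoc)
    also have "\<dots> \<le> real (2 * p + 1) * real t ^ (r - 1)"
      using base_F by (intro mult_left_mono) auto
    also have "\<dots> \<le> K" by (rule large) (use p_bounds ct in simp)
    finally show ?thesis .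
  qed
  have base_\<Delta>: "real ((t - p) * t ^ (r - 2)) \<le> \<Delta>"
  proof -
    have "real (t - p) \<le> (1 - c / 3) * real t"
      using p3 p_bounds by (simp add: of_nat_diff algebra_simps)
    then have "real (t - p) * real t ^ (r - 2) \<le> (1 - c / 3) * real t * real t ^ (r - 2)"
      by (intro mult_right_mono) auto
    then show ?thesis unfolding \<Delta>_def using tr by simp
  qed
  have \<Delta>: "real t ^ (r - 2) \<le> \<Delta>"
  proof -
    have "1 * real t ^ (r - 2) \<le> real (t - p) * real t ^ (r - 2)"
      using p3 by (intro mult_right_mono) auto
    then show ?thesis using base_\<Delta> by simp
  qed
  obtain I :: "nat list set" and E F where bl: "blocker r t K \<Delta> I E F"
    and F: "card F \<le> (t - p) * t ^ (r - 2)" and I: "card I = r"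
    using blocker_base[OF r p0 p3 base_K base_\<Delta>] by blast
  have F\<Delta>: "real (card F) \<le> \<Delta>"
    using F base_\<Delta> by (meson of_nat_mono order_trans)
  \<comment> \<open>This bridging round turns the link bound (t - p) t^(r - 2) into the pure power
    (t - p)^(r - 1) from which the iteration starts.\<close>
  have "real p * real (card F) + real (t - p) ^ (r - 1) \<le> K"
  proof -
    have "real (card F) \<le> real t ^ (r - 1)"
      using F base_F by (meson of_nat_mono order_trans)
    then have "real p * real (card F) + real (t - p) ^ (r - 1) \<le> real p * real t ^ (r - 1) + real t ^ (r - 1)"
      by (intro add_mono mult_left_mono power_mono) auto
    also have "\<dots> = (real p + 1) * real t ^ (r - 1)" by (simp add: algebra_simps)
    also have "\<dots> \<le> K" by (rule large) (use p_bounds ct in simp)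
    finally show ?thesis .
  qed
  then obtain I\<^sub>1 :: "nat list set" and E\<^sub>1 F\<^sub>1 where bl\<^sub>1: "blocker r t K \<Delta> I\<^sub>1 E\<^sub>1 F\<^sub>1"
    and F\<^sub>1: "card F\<^sub>1 \<le> (t - p) ^ (r - 1)" and I\<^sub>1: "card I\<^sub>1 \<le> (r - 1) * (1 + p * card I)"
    using blocker_step[OF bl r _ F\<Delta> \<Delta>, of p] p3 by auto
  have "(r - 1) * (1 + p * card I) \<le> t * (t * t)"
  proof (rule mult_mono)
    have "p * r \<le> t * (t - 1)" using p3 t(1) r by (intro mult_mono) auto
    moreover have "t * (t - 1) + 1 \<le> t * t" using t0 by (cases t) auto
    ultimately show "1 + p * card I \<le> t * t" using I by simp
  qed (use t in auto)
  then have I\<^sub>1': "card I\<^sub>1 \<le> t ^ 3" using I\<^sub>1 by (simp add: power3_eq_cube)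
  have b\<Delta>: "real (t - p) ^ (r - 1) \<le> \<Delta>"
  proof -
    have "(t - p) ^ (r - 1) = (t - p) * (t - p) ^ (r - 2)"
      using r by (simp flip: power_Suc add: Suc_diff_Suc numeral_2_eq_2)
    also have "\<dots> \<le> (t - p) * t ^ (r - 2)" by (intro mult_left_mono power_mono) auto
    finally have "real ((t - p) ^ (r - 1)) \<le> \<Delta>" using base_\<Delta> by (meson of_nat_mono order_trans)
    then show ?thesis by simp
  qed
  have step: "(real t - real (a - q)) * real a ^ (r - 1) + real (a - q) ^ (r - 1) \<le> K"
    if "a \<le> t - p" for a
  proof -
    have at: "real a \<le> real t" using that by simp
    have a_pow: "real a ^ (r - 1) \<le> real t ^ (r - 1)" using at by (intro power_mono) auto
    have "real q \<le> real t / real M + 1"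
      unfolding q_def using of_nat_div_le_of_nat[of t M] by simp
    also have "real t / real M \<le> \<epsilon> / 2 * real t"
      using M \<epsilon> M0 t0 by (simp add: field_simps)
    finally have q_le: "real q + 1 \<le> \<epsilon> * real t" using \<epsilon>t by simp
    \<comment> \<open>Beyond (t - a) a^(r - 1), the round pays q a^(r - 1) for the progress and at
      most t^(r - 1) for the new links. The \<epsilon> part of the budget covers both, since q + 1
      \<le> \<epsilon> t.\<close>
    have "(real t - real (a - q)) * real a ^ (r - 1) + real (a - q) ^ (r - 1)
        \<le> ((real t - real a) + real q) * real a ^ (r - 1) + real t ^ (r - 1)"
      using at by (intro add_mono mult_right_mono power_mono) auto
    also have "\<dots> = (real t - real a) * real a ^ (r - 1) + real q * real a ^ (r - 1) + real t ^ (r - 1)"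
      by (simp add: algebra_simps)
    also have "\<dots> \<le> c * real t ^ r + real q * real t ^ (r - 1) + real t ^ (r - 1)"
      unfolding c_def using diff_mult_power_le[OF r _ at] a_pow
      by (intro add_mono mult_left_mono order_refl) auto
    also have "\<dots> = c * real t ^ r + (real q + 1) * real t ^ (r - 1)"
      by (simp add: algebra_simps)
    also have "\<dots> \<le> c * real t ^ r + \<epsilon> * real t * real t ^ (r - 1)"
      using q_le by (intro add_mono mult_right_mono) auto
    also have "\<dots> = K" unfolding K_def using tr by (simp add: algebra_simps)
    finally show ?thesis .
  qed
  have "t \<le> M * q"
  proof -
    have "t = M * (t div M) + t mod M" by simp
    moreover have "t mod M < M" using M0 by simp
    moreover have "M * q = M * (t div M) + M" by (simp add: q_def)
    ultimately show ?thesis by linarith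
  qed
  \<comment> \<open>The exponent is positive because r \<ge> 2, so the vanishing base gives 0 and
    not 1.\<close>
  then have zero: "(t - p - M * q) ^ (r - 1) = 0" using r by simp
  obtain I\<^sub>2 :: "nat list set" and E\<^sub>2 F\<^sub>2 where bl\<^sub>2: "blocker r t K \<Delta> I\<^sub>2 E\<^sub>2 F\<^sub>2"
    and F\<^sub>2: "card F\<^sub>2 \<le> (t - p - M * q) ^ (r - 1)" and I\<^sub>2: "card I\<^sub>2 \<le> t ^ (2 * M + 3)"
    using blocker_iterate[OF r t(1) bl\<^sub>1 F\<^sub>1 I\<^sub>1' _ b\<Delta> \<Delta> step, where m = M] by auto
  have "card F\<^sub>2 = 0" using F\<^sub>2 unfolding zero by simp
  then have "F\<^sub>2 = {}" using blocker_finite(3)[OF bl\<^sub>2] by simp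
  then show ?thesis using bl\<^sub>2 I\<^sub>2 unfolding K_def \<Delta>_def by blast
qed

section \<open>The exponent and the threshold for t\<close>

theorem theorem4p3:
  fixes r :: nat and \<epsilon> :: real
  assumes "r \<ge> 2" and "\<epsilon> > 0"
  shows "\<exists>C::real. \<forall>\<^sub>F t::nat in sequentially. \<forall>n::nat. real n > real t powr C \<longrightarrow>
    (\<exists>(V :: nat set) (E :: nat set set) (P :: nat set set).
       uniform_hypergraph r V E \<and>
       partition_on V P \<and> card P = n \<and> thick t P \<and>
       (\<forall>e\<in>E. stretched P e) \<and>
       (\<forall>B\<in>P. real (card {e \<in> E. e \<inter> B \<noteq> {}})
          \<le> (real (r - 1) ^ (r - 1) / real r ^ r + \<epsilon>) * real t ^ r) \<and>
       (\<forall>v\<in>V. real (degree E v)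
          \<le> (1 - real (r - 1) ^ (r - 1) / (3 * real r ^ r)) * real t ^ (r - 1)) \<and>
       \<not> (\<exists>T. independent_transversal V E P T))"
proof -
  define c where "c = real (r - 1) ^ (r - 1) / real r ^ r"
  \<comment> \<open>The number of rounds depends on \<epsilon> alone, and the exponent is 2
    \<open>M\<close> + 3. The threshold below adds up all lower bounds on t.\<close>
  define M where "M = nat \<lceil>2 / \<epsilon>\<rceil>"
  define t\<^sub>0 where "t\<^sub>0 = 2 * r + 8 + nat \<lceil>9 / c\<rceil> + nat \<lceil>4 / \<epsilon>\<rceil>"
  have M: "2 / \<epsilon> \<le> real M" unfolding M_def by linarith
  have c3: "real (r - 1) ^ (r - 1) / (3 * real r ^ r) = c / 3" by (simp add: c_def)
  have "\<exists>(V :: nat set) E P. uniform_hypergraph r V E \<and>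
      partition_on V P \<and> card P = n \<and> thick t P \<and> (\<forall>e\<in>E. stretched P e) \<and>
      (\<forall>B\<in>P. real (card {e \<in> E. e \<inter> B \<noteq> {}}) \<le> (c + \<epsilon>) * real t ^ r) \<and>
      (\<forall>v\<in>V. real (degree E v) \<le> (1 - c / 3) * real t ^ (r - 1)) \<and>
      \<not> (\<exists>T. independent_transversal V E P T)"
    if "t \<ge> t\<^sub>0" and n: "real n > real t powr real (2 * M + 3)" for t n
  proof -
    have t: "2 * r \<le> t" "8 \<le> t" "9 / c \<le> real t" "4 / \<epsilon> \<le> real t"
      using \<open>t \<ge> t\<^sub>0\<close> unfolding t\<^sub>0_def by linarith+
    obtain I :: "nat list set" and E
      where bl: "blocker r t ((c + \<epsilon>) * real t ^ r) ((1 - c / 3) * real t ^ (r - 1)) I E {}"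
        and I: "card I \<le> t ^ (2 * M + 3)"
      using ex_blocker_without_links[OF assms(1) M assms(2) t(1,2) _ t(4)] t(3)
      unfolding c_def by blast
    have "real t powr real (2 * M + 3) = real (t ^ (2 * M + 3))"
      using t(2) by (subst powr_realpow) auto
    then have "t ^ (2 * M + 3) < n" using n by (simp only: of_nat_less_iff)
    then have In: "card I \<le> n" using I by linarith
    \<comment> \<open>These make both bounds nonnegative, as the padding requires.\<close>
    have c: "c \<ge> 0" "c \<le> 1"
    proof -
      have "real (r - 1) ^ (r - 1) \<le> real r ^ (r - 1)" by (intro power_mono) auto
      also have "\<dots> \<le> real r ^ r" using assms by (intro power_increasing) auto
      finally show "c \<le> 1" using assms by (simp add: c_def)
    qed (simp add: c_def)
    show ?thesis
      by (rule ex_hypergraph_of_blocker[OF bl _ _ _ _ In])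
        (use t(2) c assms in \<open>auto simp: infinite_UNIV_listI\<close>)
  qed
  then have "\<forall>\<^sub>F t in sequentially. \<forall>n. real n > real t powr real (2 * M + 3) \<longrightarrow>
      (\<exists>(V :: nat set) E P. uniform_hypergraph r V E \<and>
      partition_on V P \<and> card P = n \<and> thick t P \<and> (\<forall>e\<in>E. stretched P e) \<and>
      (\<forall>B\<in>P. real (card {e \<in> E. e \<inter> B \<noteq> {}}) \<le> (c + \<epsilon>) * real t ^ r) \<and>
      (\<forall>v\<in>V. real (degree E v) \<le> (1 - c / 3) * real t ^ (r - 1)) \<and>
      \<not> (\<exists>T. independent_transversal V E P T))"
    unfolding eventually_sequentially by blast
  then show ?thesis unfolding c3 c_def by (rule exI[of _ "real (2 * M + 3)"])
qed

end
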